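(* Let $f(x)\in\mathbb{Z}[x]$ be an irreducible polynomial of degree $n\ge 1$ and let $c$ be any integer. Define $F(x)=x^n f\left(\tfrac1x+x+c\right)$, a polynomial in $\mathbb{Z}[x]$ of degree $2n$. Then: (1) If at least one of $|F(1)|$, $|F(-1)|$ is not a perfect square, then $F(x)$ is irreducible over $\mathbb{Q}$. (2) If $F(1)$ and the middle coefficient of $F(x)$ (the coefficient of $x^n$) have opposite signs, then $F(x)$ is irreducible over $\mathbb{Q}$. (3) If the middle coefficient of $F(x)$ (the coefficient of $x^n$) is $0$, $1$ or $-1$, then $F(x)$ is irreducible over $\mathbb{Q}$.
   Context: "Irreducible" for $f$ means irreducible as an element of the ring $\mathbb{Z}[x]$ (so, being of positive degree, $f$ is primitive and irreducible over $\mathbb{Q}$). Two real numbers have opposite signs if one is strictly positive and the other strictly negative. Perfect squares are squares of integers, including $0$. *)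

theory Defs
  imports "HOL-Computational_Algebra.Computational_Algebra"
begin

text \<open>
  The polynomial \<open>x\<^sup>n f(1/x + x + c)\<close> with \<open>n = degree f\<close>. Since \<open>x (1/x + x + c) = x\<^sup>2 + c x + 1\<close>,
  the monomial \<open>y\<^sup>i\<close> of \<open>f\<close> contributes \<open>x^(n - i) (x\<^sup>2 + c x + 1)^i\<close>.
\<close>

definition recip_subst :: "int \<Rightarrow> int poly \<Rightarrow> int poly" where
  "recip_subst c f =
     (\<Sum>i\<le>degree f. smult (coeff f i) (monom 1 (degree f - i) * [:1, c, 1:] ^ i))"

text \<open>
  The defining identity. It holds in every field of characteristic 0, in particular in a field of rational functions
  with \<open>x\<close> the indeterminate.
\<close>

lemma poly_recip_subst:
  fixes x :: "'a :: field_char_0"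
  assumes "x \<noteq> 0"
  shows "poly (map_poly of_int (recip_subst c f)) x =
         x ^ degree f * poly (map_poly of_int f) (1 / x + x + of_int c)"
proof -
  have hom_add: "map_poly of_int (p + q) = (map_poly of_int p + map_poly of_int q :: 'a poly)"
    for p q by (rule poly_eqI) (simp add: coeff_map_poly)
  have hom_mult: "map_poly of_int (p * q) = (map_poly of_int p * map_poly of_int q :: 'a poly)"
    for p q by (rule poly_eqI) (simp add: coeff_map_poly coeff_mult)
  have hom_power: "map_poly of_int (p ^ k) = (map_poly of_int p ^ k :: 'a poly)" for p k
    by (induction k) (simp_all add: hom_mult)
  have hom_smult: "map_poly of_int (smult a p) = (smult (of_int a) (map_poly of_int p) :: 'a poly)"
    for a p by (rule poly_eqI) (simp add: coeff_map_poly)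
  have hom_sum: "map_poly of_int (sum g A) = (\<Sum>i\<in>A. map_poly of_int (g i) :: 'a poly)"
    for g :: "nat \<Rightarrow> int poly" and A
    by (induction A rule: infinite_finite_induct) (simp_all add: hom_add)
  have hom_monom: "map_poly of_int (monom 1 k) = (monom 1 k :: 'a poly)" for k
    by (simp add: map_poly_monom)
  have base: "poly (map_poly of_int [:1, c, 1:]) x = x * (1 / x + x + of_int c)"
    using assms by (simp add: map_poly_pCons field_simps)
  have deg: "degree (map_poly of_int f :: 'a poly) = degree f"
    by (simp add: degree_map_poly)
  have "poly (map_poly of_int (recip_subst c f)) x =
        (\<Sum>i\<le>degree f. of_int (coeff f i) * (x ^ (degree f - i) * (x * (1 / x + x + of_int c)) ^ i))"
    by (simp only: recip_subst_def hom_sum hom_smult hom_mult hom_power hom_monom poly_sum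
        poly_smult poly_mult poly_power base poly_monom mult_1_left)
  also have "\<dots> = (\<Sum>i\<le>degree f. x ^ degree f * (of_int (coeff f i) * (1 / x + x + of_int c) ^ i))"
  proof (rule sum.cong[OF refl])
    fix i assume "i \<in> {..degree f}"
    then have "x ^ degree f = x ^ (degree f - i) * x ^ i"
      by (simp flip: power_add)
    then show "of_int (coeff f i) * (x ^ (degree f - i) * (x * (1 / x + x + of_int c)) ^ i) =
      x ^ degree f * (of_int (coeff f i) * (1 / x + x + of_int c) ^ i)"
      by (simp only: power_mult_distrib mult_ac)
  qed
  also have "\<dots> = x ^ degree f * poly (map_poly of_int f) (1 / x + x + of_int c)"
    by (simp add: poly_altdef deg coeff_map_poly sum_distrib_left)
  finally show ?thesis .
qed

lemma degree_recip_subst: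
  assumes "f \<noteq> 0"
  shows "degree (recip_subst c f) = 2 * degree f"
proof -
  let ?n = "degree f"
  have deg_term: "degree (monom 1 (?n - i) * [:1, c, 1:] ^ i :: int poly) = ?n + i" if "i \<le> ?n" for i
    using that by (simp add: degree_mult_eq degree_monom_eq degree_power_eq)
  have top: "coeff (monom 1 (?n - i) * [:1, c, 1:] ^ i :: int poly) (2 * ?n) = (if i = ?n then 1 else 0)"
    if "i \<le> ?n" for i
  proof (cases "i = ?n")
    case True
    have "coeff ([:1, c, 1:] ^ ?n) (2 * ?n) = lead_coeff ([:1, c, 1:] ^ ?n)"
      by (simp add: degree_power_eq mult_2)
    also have "\<dots> = 1" by (simp add: lead_coeff_power)
    finally show ?thesis using True by simp
  next
    case False
    then show ?thesis using that deg_term[OF that] by (auto intro!: coeff_eq_0)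
  qed
  have "coeff (recip_subst c f) (2 * ?n) = (\<Sum>i\<le>?n. coeff f i * (if i = ?n then 1 else 0))"
    by (simp add: recip_subst_def coeff_sum top)
  also have "\<dots> = lead_coeff f" by (subst sum.mono_neutral_right[of _ "{?n}"]) auto
  finally have "coeff (recip_subst c f) (2 * ?n) \<noteq> 0" using assms by simp
  then have "2 * ?n \<le> degree (recip_subst c f)" by (rule le_degree)
  moreover have "degree (recip_subst c f) \<le> 2 * ?n"
    unfolding recip_subst_def
  proof (rule degree_sum_le)
    fix i assume "i \<in> {..?n}"
    then have "i \<le> ?n" by simp
    with deg_term[OF this]
    show "degree (smult (coeff f i) (monom 1 (?n - i) * [:1, c, 1:] ^ i)) \<le> 2 * ?n"
      by (intro order.trans[OF degree_smult_le]) simp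
  qed simp
  ultimately show ?thesis by simp
qed

end

theory Submission imports Defs begin

text \<open>
  Each of the three conditions excludes a factorization \<open>F = \<plusminus> g g*\<close>, where \<open>g*\<close> is the reflected polynomial
  \<open>x\<^bsup>deg g\<^esup> g(1/x)\<close> of a \<open>g \<in> \<int>[x]\<close> of degree \<open>n\<close> with \<open>g(0) \<noteq> 0\<close>. Such a factorization makes
  \<open>F(1) = \<plusminus> g(1)\<^sup>2\<close> and \<open>F(-1) = \<plusminus> g(-1)\<^sup>2\<close>, and the middle coefficient of \<open>F\<close> is
  \<open>\<plusminus>\<close> the sum of the squares of the coefficients of \<open>g\<close>, with the same sign as in the formula for \<open>F(1)\<close>.
  This sum is at least 2, because the constant and the leading coefficient of \<open>g\<close> are distinct coefficients
  and neither is zero.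

  It remains to see that a reducible \<open>F\<close> factors in this way. One of two complementary factors of \<open>F\<close> has
  degree \<open>d \<le> n\<close>, and it can be scaled to a primitive \<open>g \<in> \<int>[x]\<close>. The product \<open>g g*\<close> is a palindromic
  polynomial of degree \<open>2d\<close>, so \<open>g g* = x\<^sup>d k(1/x + x + c)\<close> for some \<open>k \<in> \<int>[x]\<close> of degree at most \<open>d\<close>
  (lemma \<open>palindromic_eq_power_times_subst\<close>). A complex root \<open>x\<close> of \<open>g\<close> is a root of \<open>F\<close>, hence
  \<open>1/x + x + c\<close> is a common root of \<open>f\<close> and \<open>k\<close>. The irreducible polynomial \<open>f\<close> therefore divides \<open>k\<close>
  (lemma \<open>irreducible_dvd_of_common_root\<close>), and since \<open>deg k \<le> d \<le> n\<close>, both degrees equal \<open>n\<close> and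
  \<open>k = u f\<close> with an integer \<open>u\<close>. Substituting back gives \<open>g g* = u F\<close>. By Gauss's lemma \<open>g g*\<close> is primitive,
  so \<open>u = \<plusminus> 1\<close> (lemma \<open>recip_subst_eq_of_factor\<close>). Working with the product \<open>g g*\<close> rather than with \<open>g\<close>
  and \<open>g*\<close> separately avoids distinguishing whether or not \<open>g\<close> is self-reciprocal.
\<close>

section \<open>Evaluating integer polynomials at complex numbers\<close>

abbreviation ceval :: "int poly \<Rightarrow> complex \<Rightarrow> complex" where
  "ceval p x \<equiv> poly (map_poly of_int p) x"

lemma map_poly_of_int_add:
  "map_poly of_int (p + q) = (map_poly of_int p + map_poly of_int q :: 'a :: ring_1 poly)"
  by (rule poly_eqI) (simp add: coeff_map_poly)

lemma map_poly_of_int_diff: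
  "map_poly of_int (p - q) = (map_poly of_int p - map_poly of_int q :: 'a :: ring_1 poly)"
  by (rule poly_eqI) (simp add: coeff_map_poly)

lemma map_poly_of_int_mult:
  "map_poly of_int (p * q) = (map_poly of_int p * map_poly of_int q :: 'a :: comm_ring_1 poly)"
  by (rule poly_eqI) (simp add: coeff_map_poly coeff_mult)

lemma map_poly_of_int_smult:
  "map_poly of_int (smult a p) = (smult (of_int a) (map_poly of_int p) :: 'a :: comm_ring_1 poly)"
  by (rule poly_eqI) (simp add: coeff_map_poly)

lemma map_poly_of_int_power:
  "map_poly of_int (p ^ k) = (map_poly of_int p ^ k :: 'a :: comm_ring_1 poly)"
  by (induction k) (simp_all add: map_poly_of_int_mult)

lemmas map_poly_of_int_hom =
  map_poly_of_int_add map_poly_of_int_diff map_poly_of_int_mult map_poly_of_int_smult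
  map_poly_of_int_power

lemma degree_map_poly_of_int:
  "degree (map_poly of_int p :: 'a :: ring_char_0 poly) = degree p"
  by (simp add: degree_map_poly)

lemma map_poly_of_int_eq_iff:
  "(map_poly of_int p :: 'a :: ring_char_0 poly) = map_poly of_int q \<longleftrightarrow> p = q"
  by (auto simp: poly_eq_iff coeff_map_poly)

lemma exists_complex_root:
  assumes "degree (p :: int poly) > 0"
  shows "\<exists>x. ceval p x = 0"
proof -
  have "\<not> constant (poly (map_poly of_int p :: complex poly))"
    using assms by (simp add: constant_degree degree_map_poly_of_int)
  then show ?thesis by (rule fundamental_theorem_of_algebra)
qed

text \<open>
  Identities that involve \<open>1/x\<close> are available only for \<open>x \<noteq> 0\<close>; multiplying both sides by \<open>x\<close> closes this
  gap, so that they still determine a polynomial.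
\<close>

lemma poly_eq_of_ceval_eq:
  assumes "\<And>x. x \<noteq> 0 \<Longrightarrow> ceval p x = ceval q x"
  shows "p = q"
proof -
  have "poly ([:0, 1:] * map_poly of_int (p - q)) x = 0" for x :: complex
    using assms[of x] by (auto simp: map_poly_of_int_diff)
  then have "[:0, 1:] * map_poly of_int (p - q) = (0 :: complex poly)"
    using poly_all_0_iff_0 by blast
  then have "(map_poly of_int p :: complex poly) = map_poly of_int q"
    by (simp add: map_poly_of_int_diff)
  then show ?thesis by (simp only: map_poly_of_int_eq_iff)
qed

text \<open>
  Over \<open>\<int>\<close>, a division with remainder only computes a multiple \<open>a p\<close> of the dividend. The factor \<open>a\<close> can be
  cancelled here, since \<open>f\<close> is prime and has too large a degree to divide a constant.
\<close>

lemma irreducible_dvd_of_dvd_smult: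
  fixes f :: "int poly"
  assumes f: "irreducible f" "degree f > 0" and "a \<noteq> 0" "f dvd smult a p"
  shows "f dvd p"
proof -
  have "prime_elem f" using f(1) by (rule irreducible_imp_prime_elem)
  moreover have "f dvd [:a:] * p" using assms(4) by simp
  ultimately have "f dvd [:a:] \<or> f dvd p" by (simp only: prime_elem_dvd_mult_iff)
  moreover have "\<not> f dvd [:a:]"
    using f(2) \<open>a \<noteq> 0\<close> by (auto dest!: dvd_imp_degree_le)
  ultimately show ?thesis by blast
qed

text \<open>
  This is the minimal polynomial argument, carried out over \<open>\<int>\<close>: pseudo-division by a nonzero
  \<open>p\<close> of least degree that vanishes at \<open>z\<close> leaves no remainder. Applied to \<open>f\<close> this gives \<open>a f = p q\<close> with
  \<open>deg q < deg f\<close>, so the prime \<open>f\<close> divides \<open>p\<close> and itself has the least degree. Dividing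
  \<open>k\<close> by \<open>f\<close> then leaves no remainder either.
\<close>

lemma irreducible_dvd_of_common_root:
  fixes f k :: "int poly"
  assumes f: "irreducible f" "degree f > 0" and z: "ceval f z = 0" "ceval k z = 0"
  shows "f dvd k"
proof -
  define P where "P = (\<lambda>p. p \<noteq> 0 \<and> ceval p z = 0)"
  have "P f" using f z by (auto simp: P_def)
  then obtain p where p: "P p" and p_min: "\<And>q. P q \<Longrightarrow> degree p \<le> degree q"
    using ex_has_least_nat[of P f degree] by blast
  have p0: "p \<noteq> 0" and pz: "ceval p z = 0" using p by (auto simp: P_def)
  have divides: "\<exists>a q. a \<noteq> 0 \<and> smult a h = g * q"
    if "ceval h z = 0" "g \<noteq> 0" "ceval g z = 0" "degree g \<le> degree p" for g h
  proof -
    obtain a q where aq: "a \<noteq> 0" "smult a h = g * q + pseudo_mod h g"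
      using pseudo_mod(1)[OF \<open>g \<noteq> 0\<close>, of h] by blast
    have "pseudo_mod h g = smult a h - g * q" using aq by simp
    then have "ceval (pseudo_mod h g) z = 0"
      using that by (simp add: map_poly_of_int_hom)
    then have "pseudo_mod h g = 0"
      using p_min[of "pseudo_mod h g"] pseudo_mod(2)[OF \<open>g \<noteq> 0\<close>, of h] that(4)
      by (fastforce simp: P_def)
    then show ?thesis using aq by auto
  qed
  have deg_p: "degree p > 0"
  proof (rule ccontr)
    assume "\<not> degree p > 0"
    then obtain b where "p = [:b:]" by (auto elim: degree_eq_zeroE)
    then show False using p0 pz by (auto simp: map_poly_pCons)
  qed
  obtain a q where aq: "a \<noteq> 0" "smult a f = p * q"
    using divides[OF z(1) p0 pz] by blast
  have q0: "q \<noteq> 0" using aq f by auto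
  have "degree f = degree p + degree q"
    using arg_cong[OF aq(2), of degree] aq(1) p0 q0 by (simp add: degree_mult_eq)
  then have "\<not> f dvd q"
    using deg_p q0 by (auto dest: dvd_imp_degree_le)
  moreover have "f dvd p * q" unfolding aq(2)[symmetric] by (rule dvd_smult) simp
  moreover have "prime_elem f" using f(1) by (rule irreducible_imp_prime_elem)
  ultimately have "f dvd p" by (simp add: prime_elem_dvd_mult_iff)
  then have "degree f \<le> degree p" using p0 by (rule dvd_imp_degree_le)
  moreover have "f \<noteq> 0" using f(2) by auto
  ultimately obtain b r where "b \<noteq> 0" "smult b k = f * r"
    using divides[OF z(2) _ z(1)] by blast
  then have "f dvd smult b k" by (metis dvd_triv_left)
  with f \<open>b \<noteq> 0\<close> show ?thesis by (rule irreducible_dvd_of_dvd_smult)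
qed

section \<open>Palindromic polynomials\<close>

text \<open>
  The palindromic symmetry is inherited from \<open>x\<^sup>2 + c x + 1\<close>, because reflection is
  multiplicative.
\<close>

lemma palindromic_base_power:
  fixes c :: "'a :: idom"
  shows "coeff ([:1, c, 1:] ^ m) (2 * m) = 1"
    and "i \<le> 2 * m \<Longrightarrow> coeff ([:1, c, 1:] ^ m) i = coeff ([:1, c, 1:] ^ m) (2 * m - i)"
proof -
  have deg: "degree ([:1, c, 1:] ^ m) = 2 * m" by (simp add: degree_power_eq)
  have "lead_coeff ([:1, c, 1:] ^ m) = 1" by (simp add: lead_coeff_power)
  then show "coeff ([:1, c, 1:] ^ m) (2 * m) = 1" by (simp add: deg)
  have "reflect_poly [:1, c, 1:] = [:1, c, 1:]"
    by (simp add: reflect_poly_def numeral_2_eq_2)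
  then have "reflect_poly ([:1, c, 1:] ^ m) = [:1, c, 1:] ^ m" by (simp add: reflect_poly_power)
  then have "coeff ([:1, c, 1:] ^ m) i = coeff (reflect_poly ([:1, c, 1:] ^ m)) i" by simp
  then show "i \<le> 2 * m \<Longrightarrow> coeff ([:1, c, 1:] ^ m) i = coeff ([:1, c, 1:] ^ m) (2 * m - i)"
    by (simp only: coeff_reflect_poly deg) simp
qed

text \<open>
  Subtracting \<open>L (x\<^sup>2 + c x + 1)\<^sup>d\<close>, where \<open>L\<close> is the coefficient of \<open>x\<^bsup>2d\<^esup>\<close>, removes the outer two
  coefficients of a palindromic polynomial. What is left is \<open>x\<close> times a polynomial that is palindromic for
  \<open>d - 1\<close>, and the removed part is \<open>x\<^sup>d\<close> times the value of \<open>L y\<^sup>d\<close> at \<open>y = 1/x + x + c\<close>. As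
  \<open>x\<^sup>2 + c x + 1\<close> is monic, the coefficients of \<open>k\<close> remain integers.
\<close>

lemma palindromic_eq_power_times_subst:
  fixes G :: "int poly" and c :: int
  assumes "degree G \<le> 2 * d" "\<And>i. i \<le> 2 * d \<Longrightarrow> coeff G i = coeff G (2 * d - i)"
  shows "\<exists>k. degree k \<le> d \<and>
    (\<forall>x. x \<noteq> 0 \<longrightarrow> ceval G x = x ^ d * ceval k (1 / x + x + of_int c))"
  using assms
proof (induction d arbitrary: G)
  case 0
  then obtain a where "G = [:a:]" by (auto elim: degree_eq_zeroE)
  then show ?case by (intro exI[of _ G]) (simp add: map_poly_pCons)
next
  case (Suc d)
  define L where "L = coeff G (2 * Suc d)"
  define G1 where "G1 = G - smult L ([:1, c, 1:] ^ Suc d)"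
  have sym: "coeff G1 i = coeff G1 (2 * Suc d - i)" if "i \<le> 2 * Suc d" for i
    unfolding G1_def coeff_diff coeff_smult
    using Suc.prems(2)[OF that] palindromic_base_power(2)[OF that, of c] by presburger
  have top: "coeff G1 (2 * Suc d) = 0"
    unfolding G1_def coeff_diff coeff_smult palindromic_base_power(1) L_def by simp
  have bot: "coeff G1 0 = 0" using sym[of 0] top by simp
  have high: "coeff G1 i = 0" if "i > 2 * Suc d" for i
  proof -
    have "coeff G i = 0" using that Suc.prems(1) by (intro coeff_eq_0) simp
    moreover have "coeff ([:1, c, 1:] ^ Suc d) i = 0"
      using that by (intro coeff_eq_0) (simp add: degree_power_eq del: power_Suc)
    ultimately show ?thesis unfolding G1_def coeff_diff coeff_smult by simp
  qed
  obtain G2 where G2: "G1 = pCons 0 G2" using bot by (cases G1) auto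
  have coeff_G2: "coeff G2 i = coeff G1 (Suc i)" for i by (simp add: G2)
  have "degree G2 \<le> 2 * d"
  proof (rule degree_le, intro allI impI)
    fix i assume "2 * d < i"
    then consider "i = 2 * d + 1" | "i > 2 * d + 1" by linarith
    then show "coeff G2 i = 0" using top high[of "Suc i"] by cases (auto simp: coeff_G2)
  qed
  moreover have "coeff G2 i = coeff G2 (2 * d - i)" if "i \<le> 2 * d" for i
    using sym[of "Suc i"] that by (simp add: coeff_G2 Suc_diff_le)
  ultimately obtain k2 where k2: "degree k2 \<le> d"
    "\<And>x. x \<noteq> 0 \<Longrightarrow> ceval G2 x = x ^ d * ceval k2 (1 / x + x + of_int c)"
    using Suc.IH[of G2] by blast
  let ?k = "k2 + monom L (Suc d)"
  have "degree ?k \<le> Suc d"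
    using k2(1) by (intro degree_add_le) (auto simp: degree_monom_le)
  moreover have "ceval G x = x ^ Suc d * ceval ?k (1 / x + x + of_int c)" if "x \<noteq> 0" for x
  proof -
    have "G = pCons 0 G2 + smult L ([:1, c, 1:] ^ Suc d)"
      unfolding G2[symmetric] G1_def by simp
    then have "ceval G x = x * ceval G2 x + of_int L * (ceval [:1, c, 1:] x) ^ Suc d"
      by (simp only: map_poly_of_int_hom poly_add poly_smult poly_power) (simp add: map_poly_pCons)
    also have "ceval [:1, c, 1:] x = x * (1 / x + x + of_int c)"
      using that by (simp add: map_poly_pCons field_simps)
    finally show ?thesis
      by (simp only: k2(2)[OF that] power_mult_distrib map_poly_of_int_add poly_add)
         (simp add: map_poly_monom poly_monom algebra_simps)
  qed
  ultimately show ?case by blast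
qed

text \<open>
  When the constant coefficient is not zero, reflection only reverses the list of coefficients.
\<close>

lemma content_reflect_poly:
  fixes p :: "int poly"
  assumes "coeff p 0 \<noteq> 0"
  shows "content (reflect_poly p) = content p"
proof -
  have "set (coeffs (reflect_poly p)) = set (coeffs p)"
  proof -
    have "dropWhile ((=) 0) (coeffs p) = coeffs p"
      using assms by (cases p) (auto simp: cCons_def)
    then show ?thesis by (simp add: coeffs_reflect_poly no_trailing_unfold)
  qed
  then show ?thesis by (simp add: content_def)
qed

text \<open>
  This coefficient becomes the middle coefficient of \<open>F\<close>, which explains the sum of squares.
\<close>

lemma coeff_mult_reflect_poly_degree:
  fixes p :: "'a :: comm_semiring_1 poly"
  shows "coeff (p * reflect_poly p) (degree p) = (\<Sum>i\<le>degree p. (coeff p i)\<^sup>2)"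
  by (auto simp: coeff_mult coeff_reflect_poly power2_eq_square intro!: sum.cong)

section \<open>Factors of the substituted polynomial\<close>

text \<open>
  The evaluation rule for reflected polynomials, with \<open>y\<close> in the place of \<open>1/x\<close>, so that it is available over
  \<open>\<int>\<close> at the units \<open>x = \<plusminus> 1\<close>.
\<close>

lemma poly_reflect_poly_of_mult_eq_1:
  fixes p :: "'a :: idom poly"
  assumes "x * y = 1"
  shows "poly (reflect_poly p) x = x ^ degree p * poly p y"
proof (induction p)
  case (pCons a p)
  show ?case
  proof (cases "p = 0")
    case False
    have "x ^ Suc (degree p) * (y * poly p y) = (x * y) * (x ^ degree p * poly p y)"
      by (simp add: mult_ac)
    then show ?thesis using pCons.IH False assms
      by (simp add: reflect_poly_pCons' poly_monom distrib_left mult_ac)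
  qed simp
qed simp

lemma coeff_0_recip_subst: "coeff (recip_subst c f) 0 = lead_coeff f"
proof -
  have "poly (recip_subst c f) 0 = (\<Sum>i\<le>degree f. coeff f i * 0 ^ (degree f - i))"
    by (simp add: recip_subst_def poly_sum poly_monom)
  also have "\<dots> = (\<Sum>i\<in>{degree f}. coeff f i * 0 ^ (degree f - i))"
    by (rule sum.mono_neutral_right) auto
  finally show ?thesis by (simp add: poly_0_coeff_0)
qed

text \<open>
  The heart of the argument: the palindromic product of \<open>g\<close> and its reflection arises by the substitution
  \<open>y = 1/x + x + c\<close> from a polynomial \<open>k\<close> that shares a root with \<open>f\<close> and whose degree leaves no room for
  anything but a constant multiple of \<open>f\<close>. The factor \<open>M\<close> allows for the denominators of a factorization
  over \<open>\<rat>\<close>.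
\<close>

lemma recip_subst_eq_of_factor:
  fixes f g :: "int poly" and c :: int
  defines "F \<equiv> recip_subst c f"
  assumes f: "irreducible f" "degree f > 0"
    and g: "content g = 1" "0 < degree g" "degree g \<le> degree f"
    and M: "M \<noteq> 0" "g dvd smult M F"
  shows "\<exists>u. \<bar>u\<bar> = 1 \<and> g * reflect_poly g = smult u F"
proof -
  let ?n = "degree f" and ?d = "degree g"
  let ?G = "g * reflect_poly g"
  have "f \<noteq> 0" using f(2) by auto
  \<comment> \<open>The constant coefficient of \<open>F\<close> is the leading coefficient of \<open>f\<close>, so 0 is not a root of \<open>g\<close>.\<close>
  have "coeff (smult M F) 0 \<noteq> 0"
    using \<open>f \<noteq> 0\<close> M(1) by (simp add: F_def coeff_0_recip_subst)
  moreover obtain r where r: "smult M F = g * r" using M(2) by (auto simp: dvd_def)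
  ultimately have g0: "coeff g 0 \<noteq> 0" by (simp add: coeff_mult)
  then have "g \<noteq> 0" by auto
  have deg_G: "degree ?G = 2 * ?d"
    using g0 \<open>g \<noteq> 0\<close> by (simp add: degree_mult_eq)
  have refl: "reflect_poly ?G = ?G" using g0 by (simp add: reflect_poly_mult mult.commute)
  have sym: "coeff ?G i = coeff ?G (2 * ?d - i)" if "i \<le> 2 * ?d" for i
  proof -
    have "coeff (reflect_poly ?G) i = coeff ?G (2 * ?d - i)"
      unfolding coeff_reflect_poly deg_G using that by simp
    then show ?thesis by (simp only: refl)
  qed
  obtain k where k: "degree k \<le> ?d"
    and eval_G: "\<And>x. x \<noteq> 0 \<Longrightarrow> ceval ?G x = x ^ ?d * ceval k (1 / x + x + of_int c)"
    using palindromic_eq_power_times_subst[OF eq_imp_le[OF deg_G] sym, of c] by blast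

  obtain x where gx: "ceval g x = 0" using exists_complex_root[OF g(2)] by blast
  have x0: "x \<noteq> 0"
  proof
    assume "x = 0"
    then show False using gx g0 by (simp add: poly_0_coeff_0 coeff_map_poly)
  qed
  let ?z = "1 / x + x + of_int c"
  from arg_cong[OF r, of "\<lambda>p. ceval p x"] have "ceval F x = 0"
    using gx M(1) by (simp add: map_poly_of_int_hom)
  then have "ceval f ?z = 0" using x0 by (simp add: F_def poly_recip_subst)
  moreover have "ceval k ?z = 0" using eval_G[OF x0] gx x0 by (simp add: map_poly_of_int_hom)
  ultimately have "f dvd k" using f by (intro irreducible_dvd_of_common_root)
  then obtain q where q: "k = f * q" by (auto simp: dvd_def)
  have "k \<noteq> 0"
  proof
    assume "k = 0"
    then have "?G = 0" using eval_G by (intro poly_eq_of_ceval_eq) simp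
    then show False using \<open>g \<noteq> 0\<close> by simp
  qed
  then have "q \<noteq> 0" using q by auto
  then have "degree k = ?n + degree q" using q \<open>f \<noteq> 0\<close> by (simp add: degree_mult_eq)
  then have d: "?d = ?n" and "degree q = 0" using k g(3) by auto
  then obtain u where u: "q = [:u:]" by (auto elim: degree_eq_zeroE)
  have "?G = smult u F"
  proof (rule poly_eq_of_ceval_eq)
    fix y :: complex
    assume "y \<noteq> 0"
    then have "ceval ?G y = y ^ ?d * ceval k (1 / y + y + of_int c)" by (rule eval_G)
    also have "\<dots> = ceval (smult u F) y"
      using \<open>y \<noteq> 0\<close>
      by (simp add: F_def poly_recip_subst map_poly_of_int_hom d q u map_poly_pCons)
    finally show "ceval ?G y = ceval (smult u F) y" .
  qed
  moreover have "\<bar>u\<bar> = 1"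
  proof -
    have "content ?G = 1" using g(1) g0 by (simp add: content_mult content_reflect_poly)
    then have "\<bar>u\<bar> * content F = 1" by (simp add: \<open>?G = smult u F\<close>)
    then have "\<bar>u\<bar> dvd 1" by (metis dvd_triv_left)
    then show ?thesis by simp
  qed
  ultimately show ?thesis by blast
qed

lemma rat_poly_clear_denominators:
  fixes p :: "rat poly"
  shows "\<exists>m g. m \<noteq> 0 \<and> smult (of_int m) p = map_poly of_int g"
proof (induction p)
  case 0
  show ?case by (intro exI[of _ 1] exI[of _ 0]) simp
next
  case (pCons a p)
  then obtain m g where mg: "m \<noteq> 0" "smult (of_int m) p = map_poly of_int g" by blast
  obtain s t where st: "a = of_int s / of_int t" "t > 0"
    by (metis quotient_of_div quotient_of_denom_pos surj_pair)
  have "smult (of_int (m * t)) (pCons a p) = map_poly of_int (pCons (m * s) (smult t g))"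
  proof -
    have "smult (of_int (m * t)) p = smult (of_int t) (smult (of_int m) p)"
      by (simp add: mult.commute)
    then show ?thesis
      using st by (simp add: mg(2) map_poly_pCons map_poly_of_int_hom)
  qed
  then show ?case using mg st by (intro exI[of _ "m * t"] exI) auto
qed

text \<open>
  The smaller of two factors over \<open>\<rat>\<close> has degree at most \<open>n\<close>. Its primitive integer multiple divides a
  multiple of \<open>F\<close> over \<open>\<int>\<close>, to which \<open>recip_subst_eq_of_factor\<close> applies.
\<close>

lemma recip_subst_eq_of_reducible:
  fixes f :: "int poly" and c :: int
  defines "F \<equiv> recip_subst c f"
  assumes f: "irreducible f" "degree f > 0"
    and red: "\<not> irreducible (map_poly rat_of_int F)"
  shows "\<exists>g u. \<bar>u\<bar> = 1 \<and> degree g = degree f \<and> coeff g 0 \<noteq> 0 \<and> F = smult u (g * reflect_poly g)"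
proof -
  let ?F = "map_poly rat_of_int F"
  have "f \<noteq> 0" using f(2) by auto
  have deg_F: "degree F = 2 * degree f" using \<open>f \<noteq> 0\<close> by (simp add: F_def degree_recip_subst)
  then have F0: "F \<noteq> 0" using f(2) by auto
  have "?F \<noteq> 0" "\<not> ?F dvd 1"
    using f(2) F0 deg_F map_poly_of_int_eq_iff[of F 0, where ?'a = rat]
    by (auto simp: is_unit_iff_degree degree_map_poly_of_int)
  then obtain a b where ab: "?F = a * b" "\<not> a dvd 1" "\<not> b dvd 1"
    using red by (auto simp: irreducible_def)
  then have ab0: "a \<noteq> 0" "b \<noteq> 0" using \<open>?F \<noteq> 0\<close> by auto
  have pos: "degree a > 0" "degree b > 0" using ab ab0 by (auto simp: is_unit_iff_degree)
  have sum: "degree a + degree b = 2 * degree f"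
    using arg_cong[OF ab(1), of degree] ab0 deg_F
    by (simp add: degree_mult_eq degree_map_poly_of_int)
  obtain p r where p: "?F = p * r" "p \<noteq> 0" "degree p > 0" "degree p \<le> degree f"
  proof (cases "degree a \<le> degree f")
    case True
    with that[of a b] ab ab0 pos show ?thesis by blast
  next
    case False
    with that[of b a] ab ab0 pos sum show ?thesis by (simp add: mult.commute)
  qed
  obtain m h where h: "m \<noteq> 0" "smult (of_int m) p = map_poly of_int h"
    using rat_poly_clear_denominators by blast
  obtain m' h' where h': "m' \<noteq> 0" "smult (of_int m') r = map_poly of_int h'"
    using rat_poly_clear_denominators by blast
  define g where "g = primitive_part h"
  have deg_h: "degree h = degree p"
    using arg_cong[OF h(2), of degree] h(1) by (simp add: degree_map_poly_of_int)
  then have "h \<noteq> 0" using p by auto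
  have "map_poly rat_of_int (smult (m * m') F) = smult (of_int m) p * smult (of_int m') r"
    using p(1) by (simp add: map_poly_of_int_hom mult_ac)
  also have "\<dots> = map_poly of_int (h * h')" by (simp add: h h' map_poly_of_int_hom)
  finally have "smult (m * m') F = h * h'" by (simp only: map_poly_of_int_eq_iff)
  then have "h dvd smult (m * m') F" by simp
  moreover have "g dvd h"
    unfolding g_def by (metis content_times_primitive_part dvd_refl dvd_smult)
  ultimately have "g dvd smult (m * m') F" by (rule dvd_trans[rotated])
  moreover have "content g = 1" "degree g = degree p"
    using \<open>h \<noteq> 0\<close> deg_h by (simp_all add: g_def)
  ultimately obtain u where u: "\<bar>u\<bar> = 1" "g * reflect_poly g = smult u F"
    using recip_subst_eq_of_factor[OF f, of g "m * m'" c] p h(1) h'(1) unfolding F_def by auto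
  \<comment> \<open>An integer of absolute value 1 is its own inverse, so \<open>u\<close> moves to the other side.\<close>
  have "u * u = 1" using u(1) by (auto simp: abs_if split: if_splits)
  then have F: "F = smult u (g * reflect_poly g)" by (simp add: u(2))
  have "u \<noteq> 0" using u(1) by auto
  have "coeff F 0 = u * (coeff g 0 * lead_coeff g)" by (subst F) (simp add: coeff_mult)
  moreover have "coeff F 0 \<noteq> 0" using \<open>f \<noteq> 0\<close> by (simp add: F_def coeff_0_recip_subst)
  ultimately have g0: "coeff g 0 \<noteq> 0" by auto
  then have "g \<noteq> 0" by auto
  then have "degree g = degree f"
    using arg_cong[OF u(2), of degree] g0 \<open>u \<noteq> 0\<close> deg_F by (simp add: degree_mult_eq)
  then show ?thesis using u(1) g0 F by blast
qed

theorem theorem1p2: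
  fixes f F :: "int poly" and n :: nat and c :: int
  assumes "irreducible f"
    and "degree f = n"
    and "n \<ge> 1"
    and "F = recip_subst c f"
  shows "(\<not> is_square \<bar>poly F 1\<bar> \<or> \<not> is_square \<bar>poly F (-1)\<bar> \<longrightarrow>
            irreducible (map_poly rat_of_int F)) \<and>
         ((poly F 1 > 0 \<and> coeff F n < 0) \<or> (poly F 1 < 0 \<and> coeff F n > 0) \<longrightarrow>
            irreducible (map_poly rat_of_int F)) \<and>
         (coeff F n \<in> {0, 1, -1} \<longrightarrow>
            irreducible (map_poly rat_of_int F))"
proof (cases "irreducible (map_poly rat_of_int F)")
  case False
  then obtain g u where u: "\<bar>u\<bar> = 1" and g: "degree g = n" "coeff g 0 \<noteq> 0"
    and F: "F = smult u (g * reflect_poly g)"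
    using recip_subst_eq_of_reducible[of f c] assms by auto
  have F1: "poly F 1 = u * (poly g 1)\<^sup>2"
    using poly_reflect_poly_of_mult_eq_1[of 1 1 g] by (simp add: F power2_eq_square)
  then have "\<bar>poly F 1\<bar> = (poly g 1)\<^sup>2"
    using u by (simp add: abs_mult)
  then have sq1: "is_square \<bar>poly F 1\<bar>" by (metis is_nth_powerI)
  have "poly F (-1) = u * (-1) ^ n * (poly g (-1))\<^sup>2"
    using poly_reflect_poly_of_mult_eq_1[of "-1" "-1" g] g(1)
    by (simp add: F power2_eq_square)
  then have "\<bar>poly F (-1)\<bar> = (poly g (-1))\<^sup>2"
    using u by (simp add: abs_mult power_abs)
  then have sq2: "is_square \<bar>poly F (-1)\<bar>" by (metis is_nth_powerI)
  \<comment> \<open>Already the constant and the leading coefficient of \<open>g\<close> contribute 2 to this sum.\<close>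
  define S where "S = (\<Sum>i\<le>n. (coeff g i)\<^sup>2)"
  have mid: "coeff F n = u * S"
    using coeff_mult_reflect_poly_degree[of g] by (simp add: F g S_def)
  have "S \<ge> 2"
  proof -
    have "(\<Sum>i\<in>{0, n}. (coeff g i)\<^sup>2) \<le> S"
      unfolding S_def by (rule sum_mono2) auto
    moreover have "coeff g n \<noteq> 0" using g by auto
    then have "(coeff g 0)\<^sup>2 \<ge> 1" "(coeff g n)\<^sup>2 \<ge> 1"
      using g(2) by (simp_all add: int_one_le_iff_zero_less)
    moreover have "(\<Sum>i\<in>{0, n}. (coeff g i)\<^sup>2) = (coeff g 0)\<^sup>2 + (coeff g n)\<^sup>2"
      using \<open>n \<ge> 1\<close> by simp
    ultimately show ?thesis by linarith
  qed
  have nonneg: "(poly g 1)\<^sup>2 \<ge> 0" by simp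
  have "u = 1 \<or> u = -1" using u by linarith
  then have "\<not> ((poly F 1 > 0 \<and> coeff F n < 0) \<or> (poly F 1 < 0 \<and> coeff F n > 0))"
    and "coeff F n \<notin> {0, 1, -1}"
    unfolding F1 mid using \<open>S \<ge> 2\<close> nonneg by auto
  with sq1 sq2 show ?thesis by blast
qed simp

end
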